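(* Let $n\geq 6$ be an integer. Then the graph $L(n)$ is vertex-pancyclic: for every vertex $v$ of $L(n)$ and every integer $l$ with $3\leq l\leq n(n-1)$, there is a cycle of length $l$ in $L(n)$ containing $v$.
   Context: Let $n\geq 3$ and $[n]=\{1,2,\dots,n\}$. The graph $B(n)$ has vertex set $\{v : v\subset [n],\ |v|\in\{1,2\}\}$, and two vertices $v,w$ are adjacent iff $v\subset w$ or $w\subset v$. The graph $L(n)$ is the line graph of $B(n)$. Equivalently, the vertices of $L(n)$ are the pairs $[i,ij]:=\{\{i\},\{i,j\}\}$ with $i,j\in[n]$, $i\neq j$ (so $L(n)$ has $n(n-1)$ vertices), and two distinct vertices $[i,ij]$ and $[r,rs]$ are adjacent iff $i=r$ or $\{i,j\}=\{r,s\}$. A graph of order $N>2$ is vertex-pancyclic if every vertex lies on a cycle of length $l$ for every $l$ with $3\leq l\leq N$. *)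

theory Defs
  imports "Graph_Theory.Pair_Digraph"
begin

text \<open>
  Finite simple graphs are loop-free symmetric digraphs in the sense of \<^locale>\<open>pair_graph\<close>:
  an edge \<open>{u, v}\<close> is the pair of arcs \<open>(u, v)\<close> and \<open>(v, u)\<close>.
\<close>

definition B_graph :: "nat \<Rightarrow> nat set pair_pre_digraph" where
  "B_graph n =
    (let V = {v. v \<subseteq> {1..n} \<and> card v \<in> {1, 2}}
     in \<lparr>pverts = V, parcs = {(v, w). v \<in> V \<and> w \<in> V \<and> (v \<subset> w \<or> w \<subset> v)}\<rparr>)"

definition line_graph :: "'a pair_pre_digraph \<Rightarrow> 'a set pair_pre_digraph" where
  "line_graph G =
    (let E = {{u, v} | u v. (u, v) \<in> parcs G}
     in \<lparr>pverts = E, parcs = {(e, f). e \<in> E \<and> f \<in> E \<and> e \<noteq> f \<and> e \<inter> f \<noteq> {}}\<rparr>)"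

definition L_graph :: "nat \<Rightarrow> nat set set pair_pre_digraph" where
  "L_graph n = line_graph (B_graph n)"

text \<open>
  \<^const>\<open>pre_digraph.cycle\<close> also admits \<open>a, b, a\<close>, which is not a cycle of an undirected graph;
  the bound \<open>3 \<le> l\<close> excludes it. A cycle is given by its nonempty list \<open>p\<close> of arcs, so its
  vertices are the tails \<open>fst ` set p\<close> and its length is \<^term>\<open>length p\<close>.
\<close>

definition vertex_pancyclic :: "'a pair_pre_digraph \<Rightarrow> bool" where
  "vertex_pancyclic G \<longleftrightarrow>
    card (pverts G) > 2 \<and>
    (\<forall>v \<in> pverts G. \<forall>l. 3 \<le> l \<and> l \<le> card (pverts G) \<longrightarrow>
      (\<exists>p. pre_digraph.cycle (with_proj G) p \<and> length p = l \<and> v \<in> fst ` set p))"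

lemma B_graph_arc_iff:
  "(v, w) \<in> parcs (B_graph n) \<longleftrightarrow>
    (\<exists>i j. i \<in> {1..n} \<and> j \<in> {1..n} \<and> i \<noteq> j \<and>
      (v = {i} \<and> w = {i, j} \<or> w = {i} \<and> v = {i, j}))" (is "?L \<longleftrightarrow> ?R")
proof
  have *: "\<exists>i j. i \<in> {1..n} \<and> j \<in> {1..n} \<and> i \<noteq> j \<and> v = {i} \<and> w = {i, j}"
    if "v \<subset> w" "w \<subseteq> {1..n}" "card v \<in> {1, 2}" "card w \<in> {1, 2}" for v w :: "nat set"
  proof -
    have "finite w" using that(2) finite_subset by blast
    then have "card v < card w" using that(1) psubset_card_mono by blast
    then have "card v = 1" "card w = 2" using that(3,4) by auto
    then obtain i a b where "v = {i}" "w = {a, b}" "a \<noteq> b"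
      by (metis card_1_singletonE card_2_iff)
    then show ?thesis using that(1,2) by (auto simp: insert_commute)
  qed
  assume ?L
  then show ?R
    using *[of v w] *[of w v] unfolding B_graph_def Let_def by simp blast
next
  assume ?R
  then show ?L unfolding B_graph_def Let_def by auto
qed

lemma pverts_L_graph:
  "pverts (L_graph n) = {{{i}, {i, j}} | i j. i \<in> {1..n} \<and> j \<in> {1..n} \<and> i \<noteq> j}"
  unfolding L_graph_def line_graph_def Let_def B_graph_arc_iff
  by (simp, safe) (metis insert_commute | blast)+

lemma parcs_L_graph:
  assumes "i \<in> {1..n}" "j \<in> {1..n}" "i \<noteq> j" "r \<in> {1..n}" "s \<in> {1..n}" "r \<noteq> s"
  shows "({{i}, {i, j}}, {{r}, {r, s}}) \<in> parcs (L_graph n) \<longleftrightarrow>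
    (i, j) \<noteq> (r, s) \<and> (i = r \<or> {i, j} = {r, s})"
proof -
  have V: "{{i}, {i, j}} \<in> pverts (L_graph n)" "{{r}, {r, s}} \<in> pverts (L_graph n)"
    using assms unfolding pverts_L_graph by blast+
  have "(e, f) \<in> parcs (L_graph n) \<longleftrightarrow>
      e \<in> pverts (L_graph n) \<and> f \<in> pverts (L_graph n) \<and> e \<noteq> f \<and> e \<inter> f \<noteq> {}" for e f
    by (simp add: L_graph_def line_graph_def Let_def)
  then show ?thesis using V assms by (auto simp: doubleton_eq_iff)
qed

lemma card_pverts_L_graph: "card (pverts (L_graph n)) = n * (n - 1)"
proof -
  let ?P = "SIGMA i:{1..n}. {1..n} - {i}"
  have "pverts (L_graph n) = (\<lambda>(i, j). {{i}, {i, j}}) ` ?P"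
  proof (rule equalityI, rule_tac [2] image_subsetI, rule subsetI)
    fix e assume "e \<in> pverts (L_graph n)"
    then obtain i j where "e = {{i}, {i, j}}" "(i, j) \<in> ?P"
      unfolding pverts_L_graph by force
    then show "e \<in> (\<lambda>(i, j). {{i}, {i, j}}) ` ?P" by (metis (mono_tags) case_prod_conv imageI)
  next
    fix z assume z: "z \<in> ?P"
    obtain i j where "z = (i, j)" by (cases z)
    then show "(case z of (i, j) \<Rightarrow> {{i}, {i, j}}) \<in> pverts (L_graph n)"
      using z unfolding pverts_L_graph by auto
  qed
  moreover have "inj_on (\<lambda>(i, j). {{i}, {i, j}}) ?P"
  proof (rule inj_onI)
    fix x y :: "nat \<times> nat"
    assume "(case x of (i, j) \<Rightarrow> {{i}, {i, j}}) = (case y of (i, j) \<Rightarrow> {{i}, {i, j}})"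
    then show "x = y" by (cases x; cases y) (auto simp: doubleton_eq_iff)
  qed
  moreover have "card ?P = n * (n - 1)"
    by (subst card_SigmaI) auto
  ultimately show ?thesis by (simp add: card_image)
qed

lemma pair_graph_L_graph: "pair_graph (L_graph n)"
proof -
  have fin: "finite (pverts (L_graph n))"
  proof (rule finite_subset)
    show "pverts (L_graph n) \<subseteq> Pow (Pow {1..n})" unfolding pverts_L_graph by auto
  qed simp
  have arcs: "(e, f) \<in> parcs (L_graph n) \<longleftrightarrow>
      e \<in> pverts (L_graph n) \<and> f \<in> pverts (L_graph n) \<and> e \<noteq> f \<and> e \<inter> f \<noteq> {}" for e f
    by (simp add: L_graph_def line_graph_def Let_def)
  have "parcs (L_graph n) \<subseteq> pverts (L_graph n) \<times> pverts (L_graph n)"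
    using arcs by auto
  then have "finite (parcs (L_graph n))" using fin finite_subset by blast
  then show ?thesis
    using fin by unfold_locales (auto simp: arcs symmetric_def sym_def)
qed

end

theory Submission
  imports Defs "Graph_Theory.Vertex_Walk"
begin

text \<open>
  Encode the vertex \<open>[i,ij]\<close> as the pair \<open>(i, j)\<close>; for fixed \<open>i\<close> these pairs form a clique of size
  \<open>n - 1\<close>. A cycle of \<open>L(n)\<close> that uses an edge inside the clique of \<open>i\<close> can absorb any missing
  vertex of this clique by rerouting that edge, and the new cycle still uses an edge of the clique.
  Hence a cycle that meets exactly the cliques of the \<open>i \<in> C\<close>, each in at least one edge, can be
  lengthened in steps of one up to length \<open>|C| (n - 1)\<close>. A triangle inside a clique yields the
  lengths \<open>3, \<dots>, n - 1\<close>. A cycle of length \<open>k \<ge> 3\<close> in the complete graph on \<open>[n]\<close> traces out a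
  cycle of length \<open>2 k\<close> in \<open>L(n)\<close>; taking \<open>k = 3\<close> and \<open>k = n\<close> yields the lengths
  \<open>6, \<dots>, 3 (n - 1)\<close> and \<open>2 n, \<dots>, n (n - 1)\<close>, and for \<open>n \<ge> 6\<close> these ranges leave no gap.
\<close>

section \<open>Closed vertex walks\<close>

lemma vwalk_arcs_split:
  "set (vwalk_arcs (p @ a # q)) = set (vwalk_arcs (p @ [a])) \<union> set (vwalk_arcs (a # q))"
  by (induction p rule: vwalk_arcs.induct) auto

lemma in_vwalk_arcs_decomp:
  assumes "(a, b) \<in> set (vwalk_arcs W)"
  obtains p q where "W = p @ a # b # q"
proof -
  have "\<exists>p q. W = p @ a # b # q"
    using assms
  proof (induction W rule: vwalk_arcs.induct)
    case (3 x y xs)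
    show ?case
    proof (cases "(a, b) = (x, y)")
      case True
      then have "x # y # xs = [] @ a # b # xs" by simp
      then show ?thesis by blast
    next
      case False
      then obtain p q where "y # xs = p @ a # b # q" using 3 by auto
      then have "x # y # xs = (x # p) @ a # b # q" by simp
      then show ?thesis by blast
    qed
  qed auto
  then show ?thesis using that by blast
qed

text \<open>The first inclusion keeps a rerouted walk inside the graph; the second saves its arcs in
  the other cliques.\<close>

lemma vwalk_arcs_insert:
  shows "set (vwalk_arcs (p @ a # w # b # q))
    \<subseteq> set (vwalk_arcs (p @ a # b # q)) \<union> {(a, w), (w, b)}"
    and "set (vwalk_arcs (p @ a # b # q)) - {(a, b)} \<union> {(a, w), (w, b)}
    \<subseteq> set (vwalk_arcs (p @ a # w # b # q))"
  using vwalk_arcs_split[of p a "w # b # q"] vwalk_arcs_split[of p a "b # q"] by auto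

lemma vwalk_arcs_map: "vwalk_arcs (map f W) = map (map_prod f f) (vwalk_arcs W)"
  by (induction W rule: vwalk_arcs.induct) auto

lemma vwalk_arcs_subset: "set (vwalk_arcs W) \<subseteq> set W \<times> set W"
  by (induction W rule: vwalk_arcs.induct) auto

lemma fst_vwalk_arcs: "map fst (vwalk_arcs W) = butlast W"
  by (induction W rule: vwalk_arcs.induct) auto

lemma length_vwalk_arcs: "length (vwalk_arcs W) = length W - 1"
  by (induction W rule: vwalk_arcs.induct) auto

lemma distinct_vwalk_arcs_neq:
  assumes "distinct W" "(x, y) \<in> set (vwalk_arcs W)"
  shows "x \<noteq> y"
  using assms by (induction W rule: vwalk_arcs.induct) auto

text \<open>Later arcs join neighbours in the distinct tail. The first arc starts at the vertex that
  also ends the walk, and with three entries or more this end lies beyond \<open>b\<close> in the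
  tail. The list \<open>[a, a]\<close> shows that two entries are too few.\<close>

lemma closed_vwalk_arcs_neq:
  assumes "hd W = last W" "distinct (tl W)" "length W \<ge> 3" "(x, y) \<in> set (vwalk_arcs W)"
  shows "x \<noteq> y"
proof -
  obtain a b c q where "W = a # b # c # q"
    using assms(3) by (metis One_nat_def Suc_le_length_iff numeral_3_eq_3)
  then show ?thesis
    using assms distinct_vwalk_arcs_neq[of "tl W" x y] by (auto split: if_splits)
qed

lemma cycle_vwalk_arcs:
  assumes "set W \<subseteq> pverts G" "set (vwalk_arcs W) \<subseteq> parcs G"
    and "hd W = last W" "distinct (tl W)" "length W \<ge> 2"
  shows "pre_digraph.cycle (with_proj G) (vwalk_arcs W)"
proof -
  have cas: "pcas (hd W) (vwalk_arcs W) (last W)" and verts: "pawalk_verts (hd W) (vwalk_arcs W) = W"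
    if "W \<noteq> []" for W :: "'a list"
    using that by (induction W rule: vwalk_arcs.induct) auto
  have "W \<noteq> []" "vwalk_arcs W \<noteq> []"
    using assms(5) length_vwalk_arcs[of W] by auto
  then show ?thesis
    using assms cas[of W] verts[of W]
    unfolding pre_digraph.cycle_def pre_digraph.awalk_def cas_with_proj_eq
      awalk_verts_with_proj_eq with_proj_simps
    by (auto intro!: exI[of _ "hd W"])
qed

section \<open>Cycles of flags\<close>

definition flags :: "nat \<Rightarrow> (nat \<times> nat) set" where
  "flags n = (SIGMA i:{1..n}. {1..n} - {i})"

text \<open>The first vertex is repeated at the end, so a cycle of length l is a list of length l +
  1. The arc condition encodes adjacency in L(n) without x \<noteq> y; for a flag x it also admits
  \<open>[x]\<close> and \<open>[x, x]\<close>, hence the length bounds below.\<close>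

definition flag_cycle :: "nat \<Rightarrow> (nat \<times> nat) list \<Rightarrow> bool" where
  "flag_cycle n W \<longleftrightarrow> W \<noteq> [] \<and> hd W = last W \<and> distinct (tl W) \<and> set W \<subseteq> flags n \<and>
    (\<forall>(x, y) \<in> set (vwalk_arcs W). fst x = fst y \<or> y = prod.swap x)"

text \<open>The invariant of the lengthening argument: each i in C keeps an arc that can be
  rerouted.\<close>

definition clique_arcs_at :: "nat set \<Rightarrow> (nat \<times> nat) list \<Rightarrow> bool" where
  "clique_arcs_at C W \<longleftrightarrow> (\<forall>i\<in>C. \<exists>d e. ((i, d), (i, e)) \<in> set (vwalk_arcs W))"

lemma card_set_flag_cycle:
  assumes "flag_cycle n W" "length W \<ge> 2"
  shows "card (set W) = length W - 1"
proof -
  obtain a b q where W: "W = a # b # q"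
    using assms(2) by (metis One_nat_def Suc_1 Suc_le_length_iff)
  then have "set W = set (tl W)"
    using assms(1) by (auto simp: flag_cycle_def)
  then show ?thesis
    using assms(1) by (metis distinct_card flag_cycle_def length_tl)
qed

lemma flag_cycle_insert:
  assumes cyc: "flag_cycle n W" and cl: "clique_arcs_at C W"
    and w: "(i, j) \<in> flags n" "i \<in> C" "(i, j) \<notin> set W"
  obtains W' where "flag_cycle n W'" "clique_arcs_at C W'"
    "set W' = insert (i, j) (set W)" "length W' = Suc (length W)"
proof -
  obtain d e where "((i, d), (i, e)) \<in> set (vwalk_arcs W)"
    using cl w(2) by (auto simp: clique_arcs_at_def)
  then obtain p q where W: "W = p @ (i, d) # (i, e) # q"
    by (rule in_vwalk_arcs_decomp)
  define W' where "W' = p @ (i, d) # (i, j) # (i, e) # q"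
  note sub = vwalk_arcs_insert[where p = p and a = "(i, d)" and w = "(i, j)" and b = "(i, e)" and q = q,
      folded W W'_def]
  have "hd W' = hd W" "last W' = last W"
    unfolding W W'_def by (cases p; simp)+
  moreover have "distinct (tl W')"
    using cyc w(3) unfolding flag_cycle_def W W'_def by (cases p) auto
  moreover have set: "set W' = insert (i, j) (set W)"
    unfolding W W'_def by auto
  moreover have "\<forall>(x, y) \<in> set (vwalk_arcs W'). fst x = fst y \<or> y = prod.swap x"
    using cyc sub(1) unfolding flag_cycle_def by fastforce
  ultimately have "flag_cycle n W'"
    using cyc w(1) by (auto simp: flag_cycle_def W'_def)
  moreover have "clique_arcs_at C W'"
    unfolding clique_arcs_at_def
  proof
    fix k assume "k \<in> C"
    then obtain d' e' where "((k, d'), (k, e')) \<in> set (vwalk_arcs W)"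
      using cl by (auto simp: clique_arcs_at_def)
    \<comment> \<open>For k = i the new arc from \<open>(i, d)\<close> to \<open>(i, j)\<close>
      serves; for other k the old arc starts outside the clique of i, so it is not the one
      removed.\<close>
    then show "\<exists>d e. ((k, d), (k, e)) \<in> set (vwalk_arcs W')"
      using sub(2) by (cases "k = i") blast+
  qed
  moreover have "length W' = Suc (length W)"
    unfolding W W'_def by simp
  ultimately show ?thesis using that set by blast
qed

text \<open>There are |C| (n - 1) flags over C, so a cycle with fewer vertices misses one of them,
  which can be inserted.\<close>

lemma flag_cycle_extend:
  assumes "flag_cycle n W" "clique_arcs_at C W" "fst ` set W \<subseteq> C" "C \<subseteq> {1..n}"
    and "2 \<le> length W" "length W \<le> Suc l" "l \<le> card C * (n - 1)"
  shows "\<exists>W'. flag_cycle n W' \<and> set W \<subseteq> set W' \<and> length W' = Suc l"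
proof -
  \<comment> \<open>Here \<open>m\<close> counts list entries, one more than the length of the
    cycle.\<close>
  have "\<exists>W'. flag_cycle n W' \<and> clique_arcs_at C W' \<and> fst ` set W' \<subseteq> C \<and> set W \<subseteq> set W' \<and>
      length W' = m" if "length W \<le> m" "m \<le> Suc (card C * (n - 1))" for m
    using that
  proof (induction m rule: dec_induct)
    case base
    then show ?case using assms(1-3) by auto
  next
    case (step m)
    then obtain W' where W': "flag_cycle n W'" "clique_arcs_at C W'" "fst ` set W' \<subseteq> C"
      "set W \<subseteq> set W'" "length W' = m"
      by auto
    have "length W' \<ge> 2" using W'(5) step.hyps(1) assms(5) by simp
    then have "card (set W') = m - 1"
      using card_set_flag_cycle W'(1,5) by simp
    moreover have "card (SIGMA i:C. {1..n} - {i}) = card C * (n - 1)"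
    proof -
      have "finite C" using assms(4) finite_subset by blast
      moreover have "card ({1..n} - {i}) = n - 1" if "i \<in> C" for i
        using that assms(4) by auto
      ultimately show ?thesis by (subst card_SigmaI) auto
    qed
    ultimately have "card (set W') < card (SIGMA i:C. {1..n} - {i})"
      using step.prems \<open>length W' \<ge> 2\<close> W'(5) by simp
    then have "\<not> (SIGMA i:C. {1..n} - {i}) \<subseteq> set W'"
      using card_mono[of "set W'" "SIGMA i:C. {1..n} - {i}"] by auto
    then obtain i j where ij: "i \<in> C" "j \<in> {1..n} - {i}" "(i, j) \<notin> set W'" by blast
    then have "(i, j) \<in> flags n" using assms(4) by (auto simp: flags_def)
    from flag_cycle_insert[OF W'(1,2) this ij(1,3)] obtain W'' where
      "flag_cycle n W''" "clique_arcs_at C W''"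
      "set W'' = insert (i, j) (set W')" "length W'' = Suc (length W')" .
    then show ?case
      using W'(3-5) ij(1) by (intro exI[of _ W'']) auto
  qed
  from this[of "Suc l"] show ?thesis using assms(6,7) by auto
qed

section \<open>The cycle of flags along a cycle of the complete graph\<close>

text \<open>Each edge of the path is crossed by a swap; at each inner vertex an arc of its clique
  leads on to the next edge.\<close>

fun flag_walk :: "nat list \<Rightarrow> (nat \<times> nat) list" where
  "flag_walk (a # b # xs) = (a, b) # (b, a) # flag_walk (b # xs)"
| "flag_walk xs = []"

lemma length_flag_walk: "length (flag_walk xs) = 2 * (length xs - 1)"
  by (induction xs rule: flag_walk.induct) auto

lemma set_flag_walk_subset: "set (flag_walk xs) \<subseteq> set xs \<times> set xs"
  by (induction xs rule: flag_walk.induct) auto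

lemma flag_walk_neq:
  assumes "distinct xs" "(a, b) \<in> set (flag_walk xs)"
  shows "a \<noteq> b"
  using assms by (induction xs rule: flag_walk.induct) auto

lemma distinct_flag_walk: "distinct xs \<Longrightarrow> distinct (flag_walk xs)"
proof (induction xs rule: flag_walk.induct)
  case (1 a b xs)
  then show ?case using set_flag_walk_subset[of "b # xs"] by auto
qed auto

lemma flag_walk_snoc:
  "xs \<noteq> [] \<Longrightarrow> flag_walk (xs @ [a]) = flag_walk xs @ [(last xs, a), (a, last xs)]"
  by (induction xs rule: flag_walk.induct) auto

text \<open>The arbitrary leading flag \<open>(a, p)\<close> carries the induction: after the edge
  from a to b, the flag \<open>(b, a)\<close> takes its place.\<close>

lemma flag_walk_arcs:
  "(x, y) \<in> set (vwalk_arcs ((a, p) # flag_walk (a # xs))) \<Longrightarrow> fst x = fst y \<or> y = prod.swap x"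
  by (induction xs arbitrary: a p) auto

lemma flag_walk_clique_arcs:
  "clique_arcs_at (set (butlast (a # xs))) ((a, p) # flag_walk (a # xs))"
proof (induction xs arbitrary: a p)
  case (Cons b xs)
  from Cons[of b a] show ?case by (auto simp: clique_arcs_at_def) blast+
qed (simp add: clique_arcs_at_def)

text \<open>The walk around the cycle ends at \<open>(i, last r)\<close>; putting this flag in front
  closes it and supplies the arc in the clique of i. If r were empty, going back from j to i would
  repeat flags.\<close>

lemma flag_cycle_of_cycle:
  assumes d: "distinct (i # j # r)" and r: "r \<noteq> []" and sub: "set (i # j # r) \<subseteq> {1..n}"
  defines "W \<equiv> (i, last r) # flag_walk (i # j # r @ [i])"
  shows "flag_cycle n W" "clique_arcs_at (set (i # j # r)) W" "fst ` set W \<subseteq> set (i # j # r)"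
    "(i, j) \<in> set W" "length W = Suc (2 * length (i # j # r))"
proof -
  let ?c = "i # j # r"
  have fw: "flag_walk (?c @ [i]) = flag_walk ?c @ [(last r, i), (i, last r)]"
    using flag_walk_snoc[of ?c i] r by simp
  have lr: "last r \<in> set r" "last r \<noteq> i" "last r \<noteq> j"
    using r d last_in_set[OF r] by auto
  \<comment> \<open>In \<open>flag_walk ?c\<close> only the flags of the edge ij contain i, and the
    closing edge differs from it.\<close>
  have new: "(last r, i) \<notin> set (flag_walk ?c)" "(i, last r) \<notin> set (flag_walk ?c)"
    using d lr set_flag_walk_subset[of "j # r"] by auto
  have "distinct (flag_walk (?c @ [i]))"
    unfolding fw using distinct_flag_walk[OF d] new lr(2) by auto
  moreover have "last W = (i, last r)"
    using fw by (simp add: W_def)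
  moreover have "set W \<subseteq> flags n"
  proof -
    have "set (flag_walk ?c) \<subseteq> flags n"
      using set_flag_walk_subset[of ?c] flag_walk_neq[OF d] sub unfolding flags_def by blast
    moreover have "(last r, i) \<in> flags n" "(i, last r) \<in> flags n"
      using lr sub by (auto simp: flags_def)
    ultimately show ?thesis using fw by (simp add: W_def)
  qed
  ultimately show "flag_cycle n W"
    using flag_walk_arcs[of _ _ i "last r" "j # r @ [i]"]
    by (auto simp: flag_cycle_def W_def simp del: flag_walk.simps)
  show "clique_arcs_at (set ?c) W"
    using flag_walk_clique_arcs[of i "j # r @ [i]" "last r"]
    by (simp add: W_def butlast_append del: flag_walk.simps)
  show "fst ` set W \<subseteq> set ?c"
    using set_flag_walk_subset[of "?c @ [i]"] by (auto simp: W_def simp del: flag_walk.simps)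
  show "(i, j) \<in> set W"
    by (simp add: W_def)
  show "length W = Suc (2 * length ?c)"
    using length_flag_walk[of "?c @ [i]"] by (simp add: W_def del: flag_walk.simps)
qed

lemma flag_cycle_through:
  assumes n: "n \<ge> 6" and ij: "(i, j) \<in> flags n" and l: "3 \<le> l" "l \<le> n * (n - 1)"
  shows "\<exists>W. flag_cycle n W \<and> (i, j) \<in> set W \<and> length W = Suc l"
proof -
  have ij': "i \<in> {1..n}" "j \<in> {1..n}" "i \<noteq> j" using ij by (auto simp: flags_def)
  have "card ({1..n} - {i, j}) = n - 2" using ij' by (subst card_Diff_subset) auto
  then have "2 \<le> card ({1..n} - {i, j})" using n by simp
  then obtain S where "S \<subseteq> {1..n} - {i, j}" "card S = 2"
    by (meson obtain_subset_with_card_n)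
  then obtain k m where km: "k \<in> {1..n} - {i, j}" "m \<in> {1..n} - {i, j}" "k \<noteq> m"
    by (auto simp: card_2_iff)
  \<comment> \<open>The cycle starts with the edge from i to j, so it passes through the flag
    \<open>(i, j)\<close>, and lengthening keeps that flag.\<close>
  have along: ?thesis
    if "distinct (i # j # r)" "r \<noteq> []" "set (i # j # r) \<subseteq> {1..n}"
      "2 * length (i # j # r) \<le> l" "l \<le> length (i # j # r) * (n - 1)" for r
  proof -
    note base = flag_cycle_of_cycle[OF that(1-3)]
    have "card (set (i # j # r)) = length (i # j # r)"
      using that(1) by (rule distinct_card)
    then have "\<exists>W'. flag_cycle n W' \<and>
        set ((i, last r) # flag_walk (i # j # r @ [i])) \<subseteq> set W' \<and> length W' = Suc l"
      using that(4,5) base(5)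
      by (intro flag_cycle_extend[OF base(1-3) that(3)]) (simp_all only:, auto)
    then show ?thesis using base(4) by blast
  qed
  \<comment> \<open>By n \<ge> 6, a length above n - 1 is at least 6, and one above 3 (n - 1) is at
    least 2 n.\<close>
  consider "l \<le> n - 1" | "6 \<le> l" "l \<le> 3 * (n - 1)" | "3 * (n - 1) < l"
    using n by linarith
  then show ?thesis
  proof cases
    case 1
    let ?W = "[(i, j), (i, k), (i, m), (i, j)]"
    have "flag_cycle n ?W" "clique_arcs_at {i} ?W"
      using ij' km by (auto simp: flag_cycle_def flags_def clique_arcs_at_def)
    from flag_cycle_extend[OF this, of l] show ?thesis
      using ij' l 1 by auto
  next
    case 2
    then show ?thesis using along[of "[k]"] ij' km by auto
  next
    case 3
    \<comment> \<open>A Hamilton cycle of the complete graph through the edge ij.\<close>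
    define r where "r = sorted_list_of_set ({1..n} - {i, j})"
    have r: "set r = {1..n} - {i, j}" "distinct r" by (auto simp: r_def)
    then have "length r = n - 2"
      using \<open>card ({1..n} - {i, j}) = n - 2\<close> distinct_card by metis
    then have len: "length (i # j # r) = n" and "r \<noteq> []" using n by auto
    moreover have "distinct (i # j # r)" "set (i # j # r) \<subseteq> {1..n}" using r ij' by auto
    moreover have "2 * n \<le> l" using 3 n by linarith
    ultimately show ?thesis
      using l(2) by (intro along[of r]) (simp_all only: len not_False_eq_True)
  qed
qed

section \<open>Transfer to the line graph\<close>

text \<open>This is the Kuratowski pair, which is why the encoding is injective.\<close>

definition flag_vertex :: "nat \<times> nat \<Rightarrow> nat set set" where
  "flag_vertex x = {{fst x}, {fst x, snd x}}"

lemma inj_flag_vertex: "inj_on flag_vertex (flags n)"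
proof (rule inj_onI)
  fix x y assume "flag_vertex x = flag_vertex y"
  then show "x = y"
    unfolding flag_vertex_def by (cases x; cases y) (auto simp: doubleton_eq_iff)
qed

lemma pverts_L_graph_flags: "pverts (L_graph n) = flag_vertex ` flags n"
proof -
  have "flag_vertex ` flags n = {flag_vertex (i, j) | i j. (i, j) \<in> flags n}" by auto
  then show ?thesis
    unfolding pverts_L_graph flag_vertex_def flags_def by (auto 0 3)
qed

lemma parcs_L_graph_flags:
  assumes "x \<in> flags n" "y \<in> flags n" "x \<noteq> y" "fst x = fst y \<or> y = prod.swap x"
  shows "(flag_vertex x, flag_vertex y) \<in> parcs (L_graph n)"
proof -
  obtain i j r s where xy: "x = (i, j)" "y = (r, s)" by (cases x; cases y)
  then have "i \<in> {1..n}" "j \<in> {1..n}" "i \<noteq> j" "r \<in> {1..n}" "s \<in> {1..n}" "r \<noteq> s"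
    using assms(1,2) by (auto simp: flags_def)
  from parcs_L_graph[OF this] show ?thesis
    using assms(3,4) xy by (auto simp: flag_vertex_def doubleton_eq_iff)
qed

lemma cycle_of_flag_cycle:
  assumes "flag_cycle n W" "length W \<ge> 3"
  shows "pre_digraph.cycle (with_proj (L_graph n)) (vwalk_arcs (map flag_vertex W))"
proof (rule cycle_vwalk_arcs)
  note W = assms(1)[unfolded flag_cycle_def]
  show "set (map flag_vertex W) \<subseteq> pverts (L_graph n)"
    using W by (auto simp: pverts_L_graph_flags)
  show "set (vwalk_arcs (map flag_vertex W)) \<subseteq> parcs (L_graph n)"
  proof -
    have "(flag_vertex x, flag_vertex y) \<in> parcs (L_graph n)"
      if "(x, y) \<in> set (vwalk_arcs W)" for x y
    proof (rule parcs_L_graph_flags)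
      show "x \<in> flags n" "y \<in> flags n"
        using that W vwalk_arcs_subset[of W] by auto
      show "x \<noteq> y"
        using closed_vwalk_arcs_neq[OF _ _ assms(2) that] W by simp
      show "fst x = fst y \<or> y = prod.swap x"
        using that W by fast
    qed
    then show ?thesis by (auto simp: vwalk_arcs_map)
  qed
  show "hd (map flag_vertex W) = last (map flag_vertex W)"
    using W by (simp add: hd_map last_map)
  have "set (tl W) \<subseteq> flags n" using W by (cases W) auto
  then show "distinct (tl (map flag_vertex W))"
    using W inj_on_subset[OF inj_flag_vertex] by (simp add: map_tl[symmetric] distinct_map)
  show "2 \<le> length (map flag_vertex W)" using assms(2) by simp
qed

theorem theorem2p3:
  fixes n :: nat
  assumes "n \<ge> 6"
  shows "vertex_pancyclic (L_graph n)"
  unfolding vertex_pancyclic_def card_pverts_L_graph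
proof (intro conjI ballI allI impI)
  have "6 * 5 \<le> n * (n - 1)" using assms by (intro mult_le_mono) auto
  then show "2 < n * (n - 1)" by simp
next
  fix v l
  assume "v \<in> pverts (L_graph n)" and l: "3 \<le> l \<and> l \<le> n * (n - 1)"
  then obtain i j where ij: "(i, j) \<in> flags n" "v = flag_vertex (i, j)"
    by (auto simp: pverts_L_graph_flags)
  obtain W where W: "flag_cycle n W" "(i, j) \<in> set W" "length W = Suc l"
    using flag_cycle_through[OF assms ij(1)] l by blast
  let ?p = "vwalk_arcs (map flag_vertex W)"
  \<comment> \<open>The tails of the arcs are all entries but the last, and the last recurs as the
    first.\<close>
  have "set W = set (butlast W)"
  proof -
    obtain x W' where xW: "W = x # W'" "W' \<noteq> []" using W(3) l by (cases W) force+
    then have "W' = butlast W' @ [x]"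
      using W(1) append_butlast_last_id[of W'] by (simp add: flag_cycle_def)
    then have "set W' = insert x (set (butlast W'))"
      by (metis rotate1.simps(2) set_rotate1 list.simps(15))
    then show ?thesis using xW by simp
  qed
  then have "v \<in> fst ` set ?p"
    using W(2) ij(2) fst_vwalk_arcs[of "map flag_vertex W"]
    by (metis image_eqI map_butlast set_map)
  moreover have "length ?p = l"
    using W(3) by (simp add: length_vwalk_arcs)
  ultimately show "\<exists>p. pre_digraph.cycle (with_proj (L_graph n)) p \<and> length p = l \<and> v \<in> fst ` set p"
    using cycle_of_flag_cycle[OF W(1)] W(3) l by fastforce
qed

end
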